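(* Let $p$ be a prime and let $n\geq 5$ be an integer with $n\geq p$. Then the $p$-width of the alternating group $A_n$ is at most three, i.e. $w_p(A_n)\leq 3$.
   Context: For a finite group $G$ and a prime $p$ dividing $|G|$, $I_p(G)$ denotes the set of elements of $G$ of order exactly $p$. The $p$-width $w_p(G)$ is the minimal $k\in\mathbb{N}$ such that every $g\in G$ can be written as a product of at most $k$ elements of $I_p(G)$. *)

theory Defs
  imports
    "HOL-Algebra.Sym_Groups"
    "HOL-Algebra.Multiplicative_Group"
    "HOL-Computational_Algebra.Primes"
    "HOL-Library.Extended_Nat"
begin

definition order_p_elements :: "nat \<Rightarrow> ('a, 'b) monoid_scheme \<Rightarrow> 'a set"
  where "order_p_elements p G = {x \<in> carrier G. group.ord G x = p}"

text \<open>The empty list contributes the empty product, i.e. the identity.\<close>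

definition products_of_order_p_elements :: "nat \<Rightarrow> ('a, 'b) monoid_scheme \<Rightarrow> nat \<Rightarrow> 'a set"
  where "products_of_order_p_elements p G k =
    {foldr (\<otimes>\<^bsub>G\<^esub>) xs \<one>\<^bsub>G\<^esub> | xs. set xs \<subseteq> order_p_elements p G \<and> length xs \<le> k}"

text \<open>
  The \<open>p\<close>-width is an extended natural number, so that it is \<open>\<infinity>\<close> if no suitable \<open>k\<close> exists
  (the elements of order \<open>p\<close> need not generate the group). Every nonempty set of extended
  naturals attains its infimum, so otherwise this is the minimal such \<open>k\<close>.
\<close>

definition p_width :: "nat \<Rightarrow> ('a, 'b) monoid_scheme \<Rightarrow> enat"
  where "p_width p G =
    Inf {enat k | k. carrier G \<subseteq> products_of_order_p_elements p G k}"

end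

theory Submission
  imports Defs
begin

text \<open>
  Two cycles whose supports meet in exactly one point multiply to a cycle on the union. This glueing
  principle drives the whole argument.

  For odd \<open>p\<close>, first multiply \<open>g\<close> by a suitable product \<open>c\<close> of disjoint \<open>p\<close>-cycles, threaded through
  all cycles of \<open>g\<close>, so that \<open>g \<circ> c\<close> is a single cycle of odd length at least \<open>p\<close>. Such a cycle is
  a product of two permutations \<open>a\<close>, \<open>b\<close> with \<open>a\<^sup>p = b\<^sup>p = id\<close>: break it into a chain of \<open>p\<close>-cycles,
  consecutive ones sharing one point, and take every other one; the last two overlap more in order to
  absorb the remainder of the length modulo \<open>p - 1\<close>. Hence \<open>g = a \<circ> b \<circ> c\<inverse>\<close>.

  For \<open>p = 2\<close> every permutation is a product of two involutions. If \<open>g\<close> is even with two fixed points,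
  both involutions can be made even by multiplying them with the transposition of these points;
  and any \<open>g\<close> acquires two fixed points after multiplication with a double transposition.
\<close>

subsection \<open>Cycles on a set\<close>

text \<open>The set is recorded because the permutation alone does not determine it: the identity is
  a cycle on the empty set and on every singleton, and such trivial cycles start the constructions
  below.\<close>

definition cycle_on :: "'a set \<Rightarrow> ('a \<Rightarrow> 'a) \<Rightarrow> bool"
  where "cycle_on A f \<longleftrightarrow> (\<exists>xs. distinct xs \<and> set xs = A \<and> f = cycle_of_list xs)"

lemma cycle_onI: "distinct xs \<Longrightarrow> set xs = A \<Longrightarrow> cycle_on A (cycle_of_list xs)"
  unfolding cycle_on_def by blast

lemma cycle_on_finite: "cycle_on A f \<Longrightarrow> finite A"
  unfolding cycle_on_def by auto

lemma cycle_on_permutes: "cycle_on A f \<Longrightarrow> f permutes A"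
  unfolding cycle_on_def using cycle_permutes by blast

lemma cycle_on_permutation: "cycle_on A f \<Longrightarrow> permutation f"
  unfolding cycle_on_def using permutation_of_cycle by blast

lemma cycle_on_not_in: "cycle_on A f \<Longrightarrow> x \<notin> A \<Longrightarrow> f x = x"
  by (rule permutes_not_in[OF cycle_on_permutes])

lemma cycle_on_singleton: "cycle_on {x} id"
  using cycle_onI[of "[x]" "{x}"] by simp

lemma cycle_on_singletonD: "cycle_on {x} f \<Longrightarrow> f = id"
  using cycle_on_permutes[of "{x}" f] by simp

lemma cycle_on_transpose: "x \<noteq> y \<Longrightarrow> cycle_on {x, y} (transpose x y)"
  using cycle_onI[of "[x, y]" "{x, y}"] by simp

lemma cycle_on_exists: "finite A \<Longrightarrow> \<exists>f. cycle_on A f"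
  using finite_distinct_list[of A] cycle_onI by blast

text \<open>\<open>cycle_of_list\<close> is the product of the transpositions of consecutive
  entries, in list order. Cutting this product at the entry \<open>x\<close> gives the two
  factors.\<close>

lemma cycle_of_list_append:
  "cycle_of_list (ys @ x # zs) = cycle_of_list (ys @ [x]) \<circ> cycle_of_list (x # zs)"
proof (induction ys rule: induct_list012)
  case (3 i j ys)
  then show ?case by (simp add: comp_assoc)
qed simp_all

section \<open>Rotating, gluing and splitting cycles\<close>

lemma cycle_on_list_first:
  assumes "cycle_on A f" "x \<in> A"
  obtains xs where "distinct (x # xs)" "set (x # xs) = A" "f = cycle_of_list (x # xs)"
proof -
  obtain ys where ys: "distinct ys" "set ys = A" "f = cycle_of_list ys"
    using assms(1) unfolding cycle_on_def by blast
  obtain us vs where uv: "ys = us @ x # vs"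
    using assms(2) ys(2) split_list[of x ys] by blast
  have "rotate (length us) ys = x # vs @ us"
    using uv rotate_append[of us "x # vs"] by simp
  moreover have "f = cycle_of_list (rotate (length us) ys)"
    using ys(1,3) cycle_of_list_rotate_independent[of ys] by simp
  ultimately show thesis
    using that[of "vs @ us"] ys uv by auto
qed

lemma cycle_on_list_split:
  assumes "cycle_on A f" "x \<in> A" "1 \<le> j" "j \<le> card A"
  obtains ys zs where "distinct (ys @ x # zs)" "set (ys @ x # zs) = A" "f = cycle_of_list (ys @ x # zs)"
    "length ys = j - 1"
proof -
  obtain xs where xs: "distinct (x # xs)" "set (x # xs) = A" "f = cycle_of_list (x # xs)"
    using cycle_on_list_first assms by metis
  have len: "length (x # xs) = card A" using xs by (metis distinct_card)
  define n where "n = length xs - (j - 1)"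
  define us vs where "us = take n xs" and "vs = drop n xs"
  have uv: "xs = us @ vs" by (simp add: us_def vs_def)
  have lv: "length vs = j - 1" using len assms by (simp add: vs_def n_def)
  \<comment> \<open>Rotating past \<open>x\<close> and \<open>us\<close> brings the last
    \<open>j - 1\<close> entries in front of \<open>x\<close>.\<close>
  have "rotate (length (x # us)) ((x # us) @ vs) = vs @ x # us"
    by (rule rotate_append)
  moreover have "f = cycle_of_list (rotate (length (x # us)) ((x # us) @ vs))"
    using xs uv cycle_of_list_rotate_independent[of "x # xs" "length (x # us)"] by simp
  ultimately show thesis
    using that[of vs us] xs uv lv by auto
qed

text \<open>Write the first cycle with the common point last and the second with it first; by
  \<open>cycle_of_list_append\<close> the two lists join into one.\<close>

lemma cycle_on_comp:
  assumes "cycle_on A f" "cycle_on B g" "A \<inter> B = {x}"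
  shows "cycle_on (A \<union> B) (f \<circ> g)"
proof -
  have "x \<in> A" "x \<in> B" using assms by auto
  have cA: "1 \<le> card A" using \<open>x \<in> A\<close> cycle_on_finite[OF assms(1)]
    by (metis One_nat_def Suc_leI card_gt_0_iff empty_iff)
  obtain ys zs where ys: "distinct (ys @ x # zs)" "set (ys @ x # zs) = A" "f = cycle_of_list (ys @ x # zs)"
    "length ys = card A - 1"
    using cycle_on_list_split[OF assms(1) \<open>x \<in> A\<close> cA] by blast
  have "length (ys @ x # zs) = card A" using ys by (metis distinct_card)
  then have "zs = []" using ys(4) cA by (cases zs) auto
  obtain us where us: "distinct (x # us)" "set (x # us) = B" "g = cycle_of_list (x # us)"
    using cycle_on_list_first[OF assms(2) \<open>x \<in> B\<close>] by blast
  have "f \<circ> g = cycle_of_list (ys @ x # us)"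
    using ys us \<open>zs = []\<close> cycle_of_list_append by metis
  moreover have "distinct (ys @ x # us)" "set (ys @ x # us) = A \<union> B"
    using ys us \<open>zs = []\<close> assms(3) by auto
  ultimately show ?thesis using cycle_onI by metis
qed

text \<open>Cutting the list at \<open>x\<close> undoes the gluing. The point \<open>x\<close>
  counts in both parts, whence the \<open>+ 1\<close> in the second size.\<close>

lemma cycle_on_split:
  assumes "cycle_on A f" "x \<in> A" "1 \<le> j" "j \<le> card A"
  obtains K U k u where "f = k \<circ> u" "cycle_on K k" "cycle_on U u" "K \<inter> U = {x}" "K \<union> U = A"
    "card K = j" "card U = card A - j + 1"
proof -
  obtain ys zs where ys: "distinct (ys @ x # zs)" "set (ys @ x # zs) = A" "f = cycle_of_list (ys @ x # zs)"
    "length ys = j - 1"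
    using cycle_on_list_split[OF assms] by blast
  have len: "length (ys @ x # zs) = card A" using ys by (metis distinct_card)
  show thesis
  proof (rule that[OF trans[OF ys(3) cycle_of_list_append]])
    show "cycle_on (set (ys @ [x])) (cycle_of_list (ys @ [x]))"
      "cycle_on (set (x # zs)) (cycle_of_list (x # zs))"
      using ys by (auto intro!: cycle_onI)
    show "set (ys @ [x]) \<inter> set (x # zs) = {x}" "set (ys @ [x]) \<union> set (x # zs) = A"
      using ys by auto
    show "card (set (ys @ [x])) = j" using ys(1,4) assms(3)
      by (subst distinct_card) auto
    show "card (set (x # zs)) = card A - j + 1" using ys(1,4) len assms(3)
      by (subst distinct_card) auto
  qed
qed

lemma cycle_on_list_two:
  assumes "cycle_on A f" "x \<in> A" "2 \<le> card A"
  obtains zs where "distinct (x # f x # zs)" "set (x # f x # zs) = A" "f = cycle_of_list (x # f x # zs)"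
proof -
  obtain xs where xs: "distinct (x # xs)" "set (x # xs) = A" "f = cycle_of_list (x # xs)"
    using cycle_on_list_first assms by metis
  have "length (x # xs) = card A" using xs by (metis distinct_card)
  then obtain y zs where yz: "xs = y # zs" using assms(3) by (cases xs) auto
  have "f x = y" using xs yz by (simp add: id_outside_supp)
  then show thesis using that xs yz by blast
qed

lemma cycle_on_apply_neq:
  assumes "cycle_on A f" "x \<in> A" "2 \<le> card A"
  shows "f x \<noteq> x"
proof -
  obtain zs where "distinct (x # f x # zs)" using cycle_on_list_two[OF assms] by blast
  then show ?thesis by (metis distinct_length_2_or_more)
qed

lemma cycle_on_apply_in: "cycle_on A f \<Longrightarrow> x \<in> A \<Longrightarrow> f x \<in> A"
  by (simp add: permutes_in_image[OF cycle_on_permutes])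

section \<open>Conjugates, shortenings, inverses, sign and powers of a cycle\<close>

lemma cycle_on_conj:
  assumes "cycle_on A f" "p permutes A"
  shows "cycle_on A (p \<circ> f \<circ> inv' p)"
proof -
  obtain xs where xs: "distinct xs" "set xs = A" "f = cycle_of_list xs"
    using assms unfolding cycle_on_def by blast
  have "p \<circ> f \<circ> inv' p = cycle_of_list (map p xs)"
    using xs conjugation_of_cycle permutes_bij[OF assms(2)] by blast
  moreover have "distinct (map p xs)" "set (map p xs) = A"
    using xs assms(2) by (auto simp: distinct_map permutes_inj_on permutes_image)
  ultimately show ?thesis using cycle_onI by metis
qed

text \<open>Transposing first makes \<open>x\<close> skip its image: \<open>x\<close> goes to
  \<open>f (f x)\<close> and \<open>f x\<close> becomes fixed. Formally, the product is a conjugate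
  of the cycle with \<open>x\<close> left out.\<close>

lemma cycle_on_drop_point:
  assumes "cycle_on A f" "x \<in> A" "2 \<le> card A"
  shows "cycle_on (A - {f x}) (f \<circ> transpose x (f x))"
proof -
  obtain zs where zs: "distinct (x # f x # zs)" "set (x # f x # zs) = A" "f = cycle_of_list (x # f x # zs)"
    using cycle_on_list_two assms by metis
  have "f \<circ> transpose x (f x)
      = transpose x (f x) \<circ> cycle_of_list (f x # zs) \<circ> inv' (transpose x (f x))"
    using zs(3) by simp
  also have "\<dots> = cycle_of_list (map (transpose x (f x)) (f x # zs))"
    by (rule conjugation_of_cycle) (use zs in auto)
  also have "map (transpose x (f x)) (f x # zs) = x # zs"
    using zs(1) by (auto intro!: map_idI simp: transpose_def)
  finally have "f \<circ> transpose x (f x) = cycle_of_list (x # zs)" .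
  moreover have "cycle_on (A - {f x}) (cycle_of_list (x # zs))"
    using zs(1,2) by (intro cycle_onI) auto
  ultimately show ?thesis by (simp only:)
qed

text \<open>Split off a transposition at \<open>x\<close>. Inversion swaps the two factors, which
  can be glued again at the same point.\<close>

lemma cycle_on_inv:
  assumes "cycle_on A f"
  shows "cycle_on A (inv' f)"
  using assms
proof (induction "card A" arbitrary: A f rule: less_induct)
  case less
  show ?case
  proof (cases "card A \<le> 1")
    case True
    have "A = {} \<or> (\<exists>x. A = {x})"
    proof (cases "card A = 0")
      case True
      then show ?thesis using cycle_on_finite[OF less.prems(1)] by simp
    next
      case False
      then have "card A = 1" using \<open>card A \<le> 1\<close> by linarith
      then show ?thesis by (rule card_1_singletonE) blast
    qed
    then have "f = id"
      using cycle_on_permutes[OF less.prems] by auto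
    then show ?thesis using less.prems by simp
  next
    case False
    then have "A \<noteq> {}" by auto
    then obtain x where "x \<in> A" by blast
    have "2 \<le> card A" using False by simp
    obtain K U k u where s: "f = k \<circ> u" "cycle_on K k" "cycle_on U u" "K \<inter> U = {x}" "K \<union> U = A"
      "card K = 2" "card U = card A - 2 + 1"
      by (rule cycle_on_split[OF less.prems \<open>x \<in> A\<close> _ \<open>2 \<le> card A\<close>]) (simp, rule that)
    obtain y where y: "K = {x, y}" "x \<noteq> y"
      using s(4,6) by (metis IntD1 card_2_iff doubleton_eq_iff insert_iff singletonD singletonI)
    have "k = transpose x y"
      using cycle_on_permutes[OF s(2)] cycle_on_apply_neq[OF s(2)] y s(6)
      by (metis id_apply insertI1 order_refl permutes_doubleton_iff)
    then have "cycle_on K (inv' k)" using s(2) by simp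
    moreover have "cycle_on U (inv' u)"
      using less.hyps[OF _ s(3)] s(7) False by simp
    moreover have "inv' f = inv' u \<circ> inv' k"
      using s(1-3) permutation_inverse_compose cycle_on_permutation by blast
    ultimately show ?thesis
      using cycle_on_comp[of U "inv' u" K "inv' k" x] s(4,5) by (simp add: Int_commute Un_commute)
  qed
qed

lemma cycle_on_evenperm:
  assumes "cycle_on A f" "A \<noteq> {}"
  shows "evenperm f \<longleftrightarrow> odd (card A)"
proof -
  have "evenperm (cycle_of_list xs) \<longleftrightarrow> odd (length xs)" if "distinct xs" "xs \<noteq> []" for xs :: "'a list"
    using that
  proof (induction xs rule: cycle_of_list.induct)
    case (1 i j cs)
    then show ?case
      using evenperm_comp[OF permutation_swap_id permutation_of_cycle, of i j "j # cs"]
      by (simp add: evenperm_swap del: comp_apply)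
  next
    case ("2_2" v)
    then show ?case by (simp add: id_def)
  qed simp
  then show ?thesis using assms unfolding cycle_on_def by (metis distinct_card set_empty)
qed

lemma cycle_on_funpow_card: "cycle_on A f \<Longrightarrow> f ^^ card A = id"
  unfolding cycle_on_def using cycle_is_id_root by (auto simp: distinct_card)

text \<open>The cycle induced by \<open>h\<close> on \<open>Q\<close> may be replaced by any other cycle on \<open>Q\<close>.\<close>

lemma cycle_on_first_return:
  assumes "cycle_on X h" "Q \<subseteq> X" "Q \<noteq> {}"
  shows "\<exists>B t. h = B \<circ> t \<and> cycle_on Q t \<and> (\<forall>t'. cycle_on Q t' \<longrightarrow> cycle_on X (B \<circ> t'))"
  using assms
proof (induction "card (X - Q)" arbitrary: X h)
  case 0
  then have "X = Q" using cycle_on_finite[OF 0(2)] by auto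
  then show ?case using 0 by (intro exI[of _ id] exI[of _ h]) auto
next
  case (Suc m)
  have "X - Q \<noteq> {}" using Suc(2) by (metis card.empty nat.distinct(1))
  then obtain x where x: "x \<in> X - Q" by blast
  have fin: "finite X" using Suc.prems cycle_on_finite by blast
  obtain y where "y \<in> Q" using Suc.prems by blast
  have "card {x, y} \<le> card X" using x \<open>y \<in> Q\<close> Suc.prems fin by (intro card_mono) auto
  then have "2 \<le> card X" using x \<open>y \<in> Q\<close> by (auto simp: card_insert_if split: if_splits)
  then obtain zs where zs: "distinct (x # h x # zs)" "set (x # h x # zs) = X" "h = cycle_of_list (x # h x # zs)"
    using cycle_on_list_two Suc.prems x by (metis DiffD1)
  define h' where "h' = cycle_of_list (h x # zs)"
  have h': "cycle_on (X - {x}) h'" unfolding h'_def using zs by (intro cycle_onI) auto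
  \<comment> \<open>Bypassing a point \<open>x\<close> outside \<open>Q\<close> splits off one
    transposition; these are collected in \<open>B\<close> until only the return map to
    \<open>Q\<close> is left.\<close>
  have hh: "h = transpose x (h x) \<circ> h'" unfolding h'_def using zs(3) by simp
  have "X - {x} - Q = X - Q - {x}" by auto
  then have "m = card (X - {x} - Q)" using Suc(2) x fin by simp
  then obtain B t where B: "h' = B \<circ> t" "cycle_on Q t" "\<forall>t'. cycle_on Q t' \<longrightarrow> cycle_on (X - {x}) (B \<circ> t')"
    using Suc(1)[OF _ h'] x Suc.prems by (metis DiffD2 subset_Diff_insert Diff_empty)
  have "cycle_on X (transpose x (h x) \<circ> B \<circ> t')" if "cycle_on Q t'" for t'
  proof -
    \<comment> \<open>Whichever cycle on \<open>Q\<close> is used, gluing at \<open>h x\<close> puts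
      \<open>x\<close> back.\<close>
    have "cycle_on ({x, h x} \<union> (X - {x})) (transpose x (h x) \<circ> (B \<circ> t'))"
      using zs B(3) that by (intro cycle_on_comp[of _ _ _ _ "h x"] cycle_on_transpose) auto
    moreover have "{x, h x} \<union> (X - {x}) = X" using zs by auto
    ultimately show ?thesis by (simp add: comp_assoc)
  qed
  then show ?case using hh B by (metis comp_assoc)
qed

text \<open>Induction, splitting off a 3-cycle: if \<open>t = k \<circ> u\<close> and
  \<open>t0\<close> is a partner of \<open>k\<close>, then \<open>u \<circ> t0\<close> is a partner
  of \<open>t\<close>. Indeed \<open>u \<circ> u\<close> is the inverse of \<open>u\<close>, so
  \<open>k \<circ> u \<circ> u \<circ> t0\<close> is conjugate by \<open>t0\<close> to
  \<open>t0 \<circ> k\<close> glued to a 3-cycle, and \<open>t0 \<circ> k\<close> is conjugate to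
  the cycle \<open>k \<circ> t0\<close>.\<close>

lemma cycle_on_odd_partner:
  assumes "cycle_on R t" "odd (card R)"
  shows "\<exists>t'. cycle_on R t' \<and> cycle_on R (t \<circ> t')"
  using assms
proof (induction "card R" arbitrary: R t rule: less_induct)
  case less
  show ?case
  proof (cases "card R = 1")
    case True
    then show ?thesis
      using less.prems cycle_on_singletonD cycle_on_singleton card_1_singletonE by (metis comp_id)
  next
    case False
    then have "3 \<le> card R" using less.prems(2) by (cases "card R = 0"; cases "card R = 2") presburger+
    have "R \<noteq> {}" using less.prems(2) by auto
    then obtain x where "x \<in> R" by blast
    have "1 \<le> card R - 2" using \<open>3 \<le> card R\<close> by simp
    obtain K U k u where s: "t = k \<circ> u" "cycle_on K k" "cycle_on U u" "K \<inter> U = {x}" "K \<union> U = R"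
      "card K = card R - 2" "card U = card R - (card R - 2) + 1"
      by (rule cycle_on_split[OF less.prems(1) \<open>x \<in> R\<close> \<open>1 \<le> card R - 2\<close> diff_le_self]) (rule that)
    have "card U = 3" using s(7) \<open>3 \<le> card R\<close> by simp
    obtain t0 where t0: "cycle_on K t0" "cycle_on K (k \<circ> t0)"
      using less.hyps[OF _ s(2)] s(6) less.prems(2) \<open>3 \<le> card R\<close> by auto
    have "cycle_on K (t0 \<circ> (k \<circ> t0) \<circ> inv' t0)"
      using cycle_on_conj t0 cycle_on_permutes by blast
    then have c: "cycle_on K (t0 \<circ> k)"
      using permutes_inv_o(1)[OF cycle_on_permutes[OF t0(1)]] by (simp add: comp_assoc)
    have u3: "u ^^ 3 = id" using cycle_on_funpow_card[OF s(3)] \<open>card U = 3\<close> by simp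
    have iu: "u \<circ> u = inv' u"
    proof -
      have "u \<circ> (u \<circ> u) = id" using u3 by (simp add: numeral_eq_Suc)
      then have "inv' u \<circ> (u \<circ> (u \<circ> u)) = inv' u" by simp
      then show ?thesis
        using permutes_inv_o(2)[OF cycle_on_permutes[OF s(3)]] by (simp add: comp_assoc[symmetric])
    qed
    have "cycle_on R ((t0 \<circ> k) \<circ> (u \<circ> u))"
      using cycle_on_comp[OF c cycle_on_inv[OF s(3)] s(4)] iu s(5) by simp
    moreover have p0: "t0 permutes R"
      using t0(1) s(5) cycle_on_permutes permutes_subset by (metis Un_upper1)
    ultimately have "cycle_on R (inv' t0 \<circ> ((t0 \<circ> k) \<circ> (u \<circ> u)) \<circ> inv' (inv' t0))"
      using cycle_on_conj permutes_inv by blast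
    moreover have "inv' t0 \<circ> ((t0 \<circ> k) \<circ> (u \<circ> u)) \<circ> inv' (inv' t0) = k \<circ> (u \<circ> u) \<circ> t0"
      using permutes_inv_inv[OF p0] permutes_inv_o(2)[OF p0]
      by (simp add: comp_assoc[symmetric])
    ultimately have "cycle_on R (t \<circ> (u \<circ> t0))"
      using s(1) by (simp add: comp_assoc)
    moreover have "cycle_on R (u \<circ> t0)"
      using cycle_on_comp[OF s(3) t0(1), of x] s(4,5) by (simp add: Int_commute Un_commute)
    ultimately show ?thesis by blast
  qed
qed

text \<open>Multiplying on the right by \<open>t\<close> only alters the return map of
  \<open>h\<close> to \<open>R\<close>, and \<open>cycle_on_odd_partner\<close> chooses
  \<open>t\<close> so that this stays a cycle. In this way a factor acquires points without breaking
  the full cycle.\<close>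

lemma cycle_on_extend:
  assumes "cycle_on X h" "R \<subseteq> X" "odd (card R)"
  obtains t where "cycle_on R t" "cycle_on X (h \<circ> t)"
proof -
  have "R \<noteq> {}" using assms by auto
  then obtain B t where B: "h = B \<circ> t" "cycle_on R t" "\<And>t'. cycle_on R t' \<Longrightarrow> cycle_on X (B \<circ> t')"
    using cycle_on_first_return[OF assms(1,2)] by blast
  obtain t' where "cycle_on R t'" "cycle_on R (t \<circ> t')"
    using cycle_on_odd_partner[OF B(2) assms(3)] by blast
  then show thesis using that B(3)[of "t \<circ> t'"] B(1) by (simp add: comp_assoc)
qed

subsection \<open>Permutations of a given period\<close>

text \<open>For prime \<open>p\<close> this means order \<open>p\<close> or the identity. Allowing
  the identity keeps the notion closed under gluing and under products with disjoint supports;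
  trivial factors are discarded at the very end.\<close>

definition period_on :: "nat \<Rightarrow> 'a set \<Rightarrow> ('a \<Rightarrow> 'a) \<Rightarrow> bool"
  where "period_on p A f \<longleftrightarrow> f permutes A \<and> f ^^ p = id"

lemma period_on_id: "period_on p A id"
  by (simp add: period_on_def permutes_id)

lemma period_on_cycle: "cycle_on A f \<Longrightarrow> card A = p \<Longrightarrow> period_on p A f"
  using cycle_on_funpow_card cycle_on_permutes unfolding period_on_def by blast

lemma period_on_permutes: "period_on p A f \<Longrightarrow> f permutes A"
  by (simp add: period_on_def)

lemma period_on_mono: "period_on p A f \<Longrightarrow> A \<subseteq> B \<Longrightarrow> period_on p B f"
  unfolding period_on_def using permutes_subset by blast

section \<open>Products, conjugates and inverses of period p\<close>

lemma permutes_disjoint_commute: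
  assumes "f permutes A" "g permutes B" "A \<inter> B = {}"
  shows "f \<circ> g = g \<circ> f"
proof
  fix x
  consider "x \<in> A" | "x \<in> B" | "x \<notin> A" "x \<notin> B" by blast
  then show "(f \<circ> g) x = (g \<circ> f) x"
  proof cases
    case 1
    then have "f x \<in> A" using assms(1) by (simp add: permutes_in_image)
    then have "g x = x" "g (f x) = f x"
      using 1 assms(2,3) by (auto intro!: permutes_not_in[of g B])
    then show ?thesis by simp
  next
    case 2
    then have "g x \<in> B" using assms(2) by (simp add: permutes_in_image)
    then have "f x = x" "f (g x) = g x"
      using 2 assms(1,3) by (auto intro!: permutes_not_in[of f A])
    then show ?thesis by simp
  next
    case 3
    then show ?thesis
      using permutes_not_in[OF assms(1)] permutes_not_in[OF assms(2)] by simp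
  qed
qed

lemma funpow_comp_commute:
  assumes "f \<circ> g = g \<circ> f"
  shows "(f \<circ> g) ^^ n = f ^^ n \<circ> g ^^ n"
proof (induction n)
  case (Suc n)
  have "f ^^ n \<circ> g = g \<circ> f ^^ n" for n
  proof (induction n)
    case (Suc n)
    have "f ^^ Suc n \<circ> g = f \<circ> (f ^^ n \<circ> g)" by (simp add: comp_assoc)
    also have "\<dots> = (f \<circ> g) \<circ> f ^^ n" unfolding Suc by (simp only: comp_assoc)
    also have "\<dots> = g \<circ> f ^^ Suc n" unfolding assms funpow.simps by (simp only: comp_assoc)
    finally show ?case .
  qed simp
  then have "g \<circ> f ^^ n = f ^^ n \<circ> g" by simp
  have "(f \<circ> g) ^^ Suc n = f \<circ> (g \<circ> f ^^ n) \<circ> g ^^ n"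
    unfolding funpow.simps Suc by (simp only: comp_assoc)
  also have "\<dots> = f ^^ Suc n \<circ> g ^^ Suc n"
    unfolding \<open>g \<circ> f ^^ n = f ^^ n \<circ> g\<close> funpow.simps by (simp only: comp_assoc)
  finally show ?case .
qed simp

lemma period_on_comp_disjoint:
  assumes "period_on p A f" "period_on p B g" "A \<inter> B = {}"
  shows "period_on p (A \<union> B) (f \<circ> g)"
proof -
  have pf: "f permutes A" and pg: "g permutes B"
    using assms(1,2) by (auto simp: period_on_def)
  have "f permutes A \<union> B" "g permutes A \<union> B"
    using permutes_subset[OF pf, of "A \<union> B"] permutes_subset[OF pg, of "A \<union> B"] by auto
  then have "f \<circ> g permutes A \<union> B" by (intro permutes_compose)
  moreover have "(f \<circ> g) ^^ p = id"
    using funpow_comp_commute[OF permutes_disjoint_commute[OF pf pg assms(3)], of p] assms(1,2)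
    by (simp add: period_on_def)
  ultimately show ?thesis unfolding period_on_def by blast
qed

lemma period_on_conj:
  assumes "period_on p A f" "q permutes A"
  shows "period_on p A (inv' q \<circ> f \<circ> q)"
proof -
  have "(inv' q \<circ> f \<circ> q) ^^ n = inv' q \<circ> f ^^ n \<circ> q" for n
  proof (induction n)
    case 0
    then show ?case using permutes_inv_o(2)[OF assms(2)] by simp
  next
    case (Suc n)
    have "(inv' q \<circ> f \<circ> q) ^^ Suc n = inv' q \<circ> f \<circ> (q \<circ> inv' q) \<circ> f ^^ n \<circ> q"
      unfolding funpow.simps Suc by (simp only: comp_assoc)
    also have "\<dots> = inv' q \<circ> f ^^ Suc n \<circ> q"
      unfolding permutes_inv_o(1)[OF assms(2)] funpow.simps by (simp only: comp_assoc id_comp)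
    finally show ?case .
  qed
  then have "(inv' q \<circ> f \<circ> q) ^^ p = id"
    using assms(1) permutes_inv_o(2)[OF assms(2)] unfolding period_on_def by (metis comp_id)
  moreover have "inv' q \<circ> f \<circ> q permutes A"
    using assms by (simp add: period_on_def permutes_compose permutes_inv)
  ultimately show ?thesis by (simp add: period_on_def)
qed

lemma period_on_inv:
  assumes "period_on p A f"
  shows "period_on p A (inv' f)"
proof -
  have pf: "f permutes A" using assms by (simp add: period_on_def)
  have "inv' f \<circ> f = f \<circ> inv' f" using permutes_inv_o[OF pf] by simp
  then have "(inv' f \<circ> f) ^^ p = inv' f ^^ p \<circ> f ^^ p" by (rule funpow_comp_commute)
  then have "inv' f ^^ p = id" using permutes_inv_o(2)[OF pf] assms by (simp add: period_on_def)
  then show ?thesis using permutes_inv[OF pf] by (simp add: period_on_def)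
qed

text \<open>For odd \<open>p\<close> the power \<open>f ^^ p\<close> has the parity of
  \<open>f\<close>, so evenness of the factors comes for free.\<close>

lemma period_on_odd_evenperm:
  assumes "period_on p A f" "odd p" "finite A"
  shows "evenperm f"
proof -
  have pf: "permutation f"
    using assms permutes_imp_permutation by (auto simp: period_on_def)
  have "evenperm (f ^^ n) \<longleftrightarrow> even n \<or> evenperm f" for n
    by (induction n) (auto simp: evenperm_comp[OF pf permutation_funpow[OF pf]] simp del: comp_apply)
  then show ?thesis using assms(1,2) by (metis evenperm_id period_on_def)
qed

lemma period_two_transpose: "x \<in> A \<Longrightarrow> y \<in> A \<Longrightarrow> period_on 2 A (transpose x y)"
  by (simp add: period_on_def permutes_swap_id numeral_eq_Suc)

text \<open>Rewriting \<open>a \<circ> b\<close> as \<open>b \<circ> (inv b \<circ> a \<circ> b)\<close> moves a fixed point to the second factor.\<close>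

lemma factor_swap:
  assumes "h = a \<circ> b" "period_on p X a" "period_on p X b" "a (b z) = b z"
  shows "\<exists>a b. period_on p X a \<and> period_on p X b \<and> h = a \<circ> b \<and> b z = z"
proof (intro exI conjI)
  have pb: "b permutes X" using assms(3) by (simp add: period_on_def)
  show "period_on p X b" by fact
  show "period_on p X (inv' b \<circ> a \<circ> b)" using period_on_conj assms(2) pb by blast
  show "h = b \<circ> (inv' b \<circ> a \<circ> b)"
    using assms(1) permutes_inv_o(1)[OF pb] by (simp add: comp_assoc[symmetric])
  show "(inv' b \<circ> a \<circ> b) z = z" using assms(4) permutes_inverses(2)[OF pb] by simp
qed

text \<open>As \<open>b\<close> fixes \<open>z\<close>, it lives on \<open>K - {z}\<close>, disjoint
  from \<open>U\<close>, so \<open>b \<circ> u\<close> has period \<open>p\<close>. As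
  \<open>u z\<close> lies outside \<open>K\<close>, it is fixed by \<open>a\<close>, and
  \<open>factor_swap\<close> restores a second factor fixing \<open>z\<close>. Hence the step can be
  repeated at the same point.\<close>

lemma factor_glue:
  assumes "period_on p K a" "period_on p K b" "b z = z" "period_on p U u" "K \<inter> U = {z}" "u z \<noteq> z"
  shows "\<exists>a' b'. period_on p (K \<union> U) a' \<and> period_on p (K \<union> U) b' \<and> (a \<circ> b) \<circ> u = a' \<circ> b' \<and> b' z = z"
proof (rule factor_swap)
  show "(a \<circ> b) \<circ> u = a \<circ> (b \<circ> u)" by (rule comp_assoc)
  show "period_on p (K \<union> U) a" using period_on_mono assms(1) by blast
  have "b permutes K - {z}"
    using assms(3) by (intro permutes_superset[OF period_on_permutes[OF assms(2)]]) auto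
  then have "period_on p (K - {z}) b" using assms(2) by (simp add: period_on_def)
  then have "period_on p (K - {z} \<union> U) (b \<circ> u)"
    using assms(4,5) by (intro period_on_comp_disjoint) auto
  moreover have "K - {z} \<union> U = K \<union> U" using assms(5) by auto
  ultimately show "period_on p (K \<union> U) (b \<circ> u)" by simp
  have "u z \<in> U" using permutes_in_image[OF period_on_permutes[OF assms(4)]] assms(5) by blast
  then have "u z \<notin> K" using assms(5,6) by blast
  then show "a ((b \<circ> u) z) = (b \<circ> u) z"
    using permutes_not_in[OF period_on_permutes[OF assms(1)]]
      permutes_not_in[OF period_on_permutes[OF assms(2)]] by simp
qed

section \<open>Factoring a single cycle into two permutations of period p\<close>

lemma cycle_on_two_involutions:
  assumes "cycle_on X h" "z \<in> X"
  shows "\<exists>a b. period_on 2 X a \<and> period_on 2 X b \<and> h = a \<circ> b \<and> b z = z"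
  using assms
proof (induction "card X" arbitrary: X h rule: less_induct)
  case less
  show ?case
  proof (cases "card X = 1")
    case True
    then obtain x where "X = {x}" by (rule card_1_singletonE)
    then have "h = id" using less.prems(1) cycle_on_singletonD[of x h] by simp
    then have "h = id \<circ> id" by simp
    then show ?thesis using period_on_id[of 2 X] id_apply[of z] by blast
  next
    case False
    have "card X \<noteq> 0" using cycle_on_finite[OF less.prems(1)] less.prems(2) by auto
    then have ge: "1 \<le> card X - 1" using False by simp
    obtain K U k u where s: "h = k \<circ> u" "cycle_on K k" "cycle_on U u" "K \<inter> U = {z}" "K \<union> U = X"
      "card K = card X - 1" "card U = card X - (card X - 1) + 1"
      by (rule cycle_on_split[OF less.prems ge diff_le_self]) (rule that)
    have U2: "card U = 2" using s(7) ge by simp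
    have zz: "z \<in> K" "z \<in> U" using s(4) by auto
    obtain a b where ab: "period_on 2 K a" "period_on 2 K b" "k = a \<circ> b" "b z = z"
      using less.hyps[OF _ s(2) zz(1)] s(6) ge by auto
    have "u z \<noteq> z" using cycle_on_apply_neq[OF s(3) zz(2)] U2 by simp
    then show ?thesis
      using factor_glue[OF ab(1,2,4) period_on_cycle[OF s(3) U2] s(4)] s(1,5) ab(3) by simp
  qed
qed

lemma cycle_on_two_period:
  assumes "cycle_on X h" "z \<in> X" "odd p" "3 \<le> p" "odd (card X)" "p \<le> card X"
  shows "\<exists>a b. period_on p X a \<and> period_on p X b \<and> h = a \<circ> b \<and> b z = z"
  using assms
proof (induction "card X" arbitrary: X h rule: less_induct)
  case less
  consider "card X = p" | "p < card X" "card X < 2 * p" | "2 * p \<le> card X"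
    using less.prems(6) by linarith
  then show ?case
  proof cases
    case 1
    then show ?thesis
      using period_on_cycle[OF less.prems(1)] period_on_id by (intro exI[of _ h] exI[of _ id]) auto
  next
    case 2
    have "1 \<le> p" using less.prems(4) by simp
    obtain K U k u where s: "h = k \<circ> u" "cycle_on K k" "cycle_on U u" "K \<inter> U = {z}" "K \<union> U = X"
      "card K = p" "card U = card X - p + 1"
      by (rule cycle_on_split[OF less.prems(1,2) \<open>1 \<le> p\<close> less.prems(6)]) (rule that)
    have zz: "z \<in> K" "z \<in> U" using s(4) by auto
    have fin: "finite K" "finite U" using s(2,3) cycle_on_finite by auto
    \<comment> \<open>\<open>Q\<close> will have \<open>2 * p - card X\<close> points including
      \<open>z\<close>: an odd number, as \<open>cycle_on_extend\<close> demands, and just enough to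
      give \<open>Q \<union> U\<close> exactly \<open>p\<close> points.\<close>
    have "2 * p - card X - 1 \<le> card (K - {z})" using s(6) zz fin 2 by simp
    then obtain Q0 where Q0: "Q0 \<subseteq> K - {z}" "card Q0 = 2 * p - card X - 1" "finite Q0"
      by (rule obtain_subset_with_card_n)
    define Q where "Q = insert z Q0"
    have Q: "Q \<subseteq> K" "Q \<inter> U = {z}" using Q0 s(4) zz by (auto simp: Q_def)
    have cQ: "card Q = 2 * p - card X" using Q0 2 by (auto simp: Q_def card_insert_if)
    then have "odd (card Q)" using less.prems(5) 2 by simp
    then obtain t where t: "cycle_on Q t" "cycle_on K (k \<circ> t)"
      using cycle_on_extend[OF s(2) Q(1)] by blast
    have cyc: "cycle_on (Q \<union> U) (inv' t \<circ> u)"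
      using cycle_on_comp[OF cycle_on_inv[OF t(1)] s(3) Q(2)] .
    have "card (Q \<union> U) + card (Q \<inter> U) = card Q + card U"
      using card_Un_Int[of Q U] fin Q(1) finite_subset by fastforce
    then have "card (Q \<union> U) = p" using Q(2) cQ s(7) 2 by simp
    show ?thesis
    proof (rule factor_swap)
      \<comment> \<open>Inserting \<open>t\<close> and its inverse turns the two factors into
        \<open>p\<close>-cycles on \<open>K\<close> and on \<open>Q \<union> U\<close>.\<close>
      show "h = (k \<circ> t) \<circ> (inv' t \<circ> u)"
        using s(1) permutes_inv_o(1)[OF cycle_on_permutes[OF t(1)]] by (simp add: fun_eq_iff)
      show "period_on p X (k \<circ> t)"
        using period_on_mono[OF period_on_cycle[OF t(2) s(6)]] s(5) by blast
      show "period_on p X (inv' t \<circ> u)"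
        using period_on_mono[OF period_on_cycle[OF cyc \<open>card (Q \<union> U) = p\<close>]] s(5) Q(1) by blast
      have "u z \<noteq> z" using cycle_on_apply_neq[OF s(3) zz(2)] s(7) 2 by simp
      then have nK: "u z \<notin> K" using cycle_on_apply_in[OF s(3) zz(2)] s(4) by blast
      then have "(inv' t \<circ> u) z = u z"
        using cycle_on_not_in[OF cycle_on_inv[OF t(1)]] Q(1) by auto
      then show "(k \<circ> t) ((inv' t \<circ> u) z) = (inv' t \<circ> u) z"
        using cycle_on_not_in[OF t(2) nK] by simp
    qed
  next
    case 3
    \<comment> \<open>Peeling off a \<open>p\<close>-cycle removes \<open>p - 1\<close> points, an
      even number, so what remains is still odd and at least \<open>p\<close>.\<close>
    have ge: "1 \<le> card X - p + 1" "card X - p + 1 \<le> card X" using 3 less.prems(4) by auto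
    obtain K U k u where s: "h = k \<circ> u" "cycle_on K k" "cycle_on U u" "K \<inter> U = {z}" "K \<union> U = X"
      "card K = card X - p + 1" "card U = card X - (card X - p + 1) + 1"
      by (rule cycle_on_split[OF less.prems(1,2) ge]) (rule that)
    have zz: "z \<in> K" "z \<in> U" using s(4) by auto
    have cU: "card U = p" using s(7) 3 less.prems(4) by simp
    have cK: "card K < card X" "odd (card K)" "p \<le> card K" using s(6) 3 less.prems(3-5) by auto
    obtain a b where ab: "period_on p K a" "period_on p K b" "k = a \<circ> b" "b z = z"
      using less.hyps[OF cK(1) s(2) zz(1) less.prems(3,4) cK(2,3)] by blast
    have "u z \<noteq> z" using cycle_on_apply_neq[OF s(3) zz(2)] cU less.prems(4) by simp
    then show ?thesis
      using factor_glue[OF ab(1,2,4) period_on_cycle[OF s(3) cU] s(4)] s(1,5) ab(3) by simp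
  qed
qed

section \<open>Derangements, cycle by cycle\<close>

lemma derangement_induct [consumes 3, case_names empty cycle]:
  assumes "finite X" "g permutes X" "\<forall>x\<in>X. g x \<noteq> x"
    and "P {} id"
    and step: "\<And>A f X g. \<lbrakk>cycle_on A f; 2 \<le> card A; A \<inter> X = {}; finite X; g permutes X; P X g\<rbrakk>
      \<Longrightarrow> P (A \<union> X) (f \<circ> g)"
  shows "P X g"
proof -
  have "cycle_decomp X g" using cycle_decomposition assms(1,2) by blast
  \<comment> \<open>The decomposition covers all permutations, so the absence of fixed points
    becomes a premise inside the induction and descends to the remaining cycles.\<close>
  then have "finite X \<and> g permutes X \<and> ((\<forall>x\<in>X. g x \<noteq> x) \<longrightarrow> P X g)"
  proof induction
    case empty
    then show ?case using assms(4) permutes_id by blast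
  next
    case (comp I g cs)
    let ?f = "cycle_of_list cs"
    have cyc: "cycle_on (set cs) ?f" using comp cycle_onI by blast
    have perm: "g permutes I" and fin: "finite I" using comp by auto
    have "?f permutes set cs \<union> I" "g permutes set cs \<union> I"
      using permutes_subset[OF cycle_on_permutes[OF cyc]] permutes_subset[OF perm] by auto
    then have "?f \<circ> g permutes set cs \<union> I" by (intro permutes_compose)
    moreover have "P (set cs \<union> I) (?f \<circ> g)" if nf: "\<forall>x\<in>set cs \<union> I. (?f \<circ> g) x \<noteq> x"
    proof -
      have "g x \<noteq> x" if "x \<in> I" for x
      proof -
        have "g x \<in> I" using perm that by (simp add: permutes_in_image)
        then have "?f (g x) = g x" using comp(3) by (intro cycle_on_not_in[OF cyc]) auto
        then show ?thesis using nf that by (metis UnI2 comp_apply)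
      qed
      then have "P I g" using comp by blast
      show ?thesis
      \<comment> \<open>A list with one entry would create a fixed point, so a short list is empty
        and changes nothing.\<close>
      proof (cases "length cs \<le> 1")
        case True
        then have "?f = id" by (cases cs rule: cycle_of_list.cases) auto
        moreover have "cs = []"
        proof (rule ccontr)
          assume "cs \<noteq> []"
          then obtain x where x: "x \<in> set cs" by fastforce
          then have "g x = x" using comp(3) by (intro permutes_not_in[OF perm]) auto
          then show False using nf x \<open>?f = id\<close> by auto
        qed
        ultimately show ?thesis using \<open>P I g\<close> by simp
      next
        case False
        then have "2 \<le> card (set cs)" using comp(2) distinct_card[of cs] by simp
        then show ?thesis using step[OF cyc _ comp(3) fin perm \<open>P I g\<close>] by blast
      qed
    qed
    ultimately show ?case using fin by blast
  qed
  then show ?thesis using assms(3) by blast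
qed

lemma permutes_support:
  assumes "g permutes N"
  shows "g permutes {x \<in> N. g x \<noteq> x}"
  by (rule permutes_superset[OF assms]) auto

text \<open>Factor each cycle separately; factors belonging to different cycles have disjoint
  supports and may be interchanged.\<close>

lemma two_involutions:
  assumes "finite X" "g permutes X" "\<forall>x\<in>X. g x \<noteq> x"
  shows "\<exists>a b. period_on 2 X a \<and> period_on 2 X b \<and> g = a \<circ> b"
  using assms
proof (induction rule: derangement_induct)
  case empty
  have "id = (id :: 'a \<Rightarrow> 'a) \<circ> id" by simp
  then show ?case using period_on_id by blast
next
  case (cycle A f X g)
  then obtain a b where ab: "period_on 2 X a" "period_on 2 X b" "g = a \<circ> b" by blast
  have "A \<noteq> {}" using cycle(2) by auto
  then obtain z where "z \<in> A" by blast
  obtain a' b' where ab': "period_on 2 A a'" "period_on 2 A b'" "f = a' \<circ> b'"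
    using cycle_on_two_involutions[OF cycle(1) \<open>z \<in> A\<close>] by blast
  have "b' \<circ> a = a \<circ> b'"
    using permutes_disjoint_commute ab(1) ab'(2) cycle(3) period_on_permutes by blast
  then have "f \<circ> g = (a' \<circ> a) \<circ> (b' \<circ> b)"
    unfolding ab ab' by (metis comp_assoc)
  moreover have "period_on 2 (A \<union> X) (a' \<circ> a)" "period_on 2 (A \<union> X) (b' \<circ> b)"
    using period_on_comp_disjoint ab(1,2) ab'(1,2) cycle(3) by blast+
  ultimately show ?case by blast
qed

subsection \<open>Merging all cycles into one\<close>

text \<open>
  Here \<open>c\<close> consists of the completed \<open>p\<close>-cycles and \<open>d\<close> is the one under construction. Every cycle of
  \<open>g\<close> has at least two points, so enough of \<open>X\<close> stays unused to complete \<open>d\<close> later. The point \<open>q\<close>,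
  whose image is unused, serves to shorten the merged cycle by one when its length is even.
\<close>

lemma merge_cycles:
  assumes "finite X" "g permutes X" "\<forall>x\<in>X. g x \<noteq> x" "2 \<le> p"
  shows "X = {} \<or> (\<exists>c d U Q q. period_on p U c \<and> cycle_on Q d \<and> cycle_on X (g \<circ> c \<circ> d)
    \<and> U \<inter> Q = {} \<and> U \<union> Q \<subseteq> X \<and> q \<in> Q \<and> (g \<circ> c \<circ> d) q \<in> X - (U \<union> Q) \<and> card Q \<le> p
    \<and> card U + 2 * card Q \<le> card X \<and> (U = {} \<or> card U + 2 * card Q + p \<le> card X + 2))"
  (is "_ \<or> ?M X g")
  using assms(1-3)
proof (induction rule: derangement_induct)
  case empty
  then show ?case by simp
next
  case (cycle A f X g)
  have finA: "finite A" using cycle_on_finite cycle(1) by blast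
  have "A \<noteq> {}" using cycle(2) by auto
  then obtain a where a: "a \<in> A" by blast
  have fa: "f a \<in> A" "f a \<noteq> a" "a \<notin> X"
    using cycle_on_apply_in[OF cycle(1) a] cycle_on_apply_neq[OF cycle(1) a cycle(2)] cycle(3) a by auto
  have crd: "card (A \<union> X) = card A + card X" using finA cycle by (simp add: card_Un_disjoint)
  \<comment> \<open>One transposition \<open>transpose q a\<close> both lengthens \<open>d\<close>
    by the point \<open>a\<close> and links the new cycle \<open>f\<close> to the merged
    one.\<close>
  have extend: "?M (A \<union> X) (f \<circ> g)"
    if H: "period_on p U c" "cycle_on Q d" "cycle_on X (g \<circ> c \<circ> d)" "U \<inter> Q = {}" "U \<union> Q \<subseteq> X" "q \<in> Q"
      "card Q < p" "card U + 2 * card Q \<le> card X" "U = {} \<or> card U + 2 * card Q + p \<le> card X + 2"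
    for c d U Q q
  proof -
    have q: "q \<in> X" "q \<noteq> a" using H(5,6) fa by auto
    have finQ: "finite Q" using H(2) cycle_on_finite by blast
    have d': "cycle_on (Q \<union> {q, a}) (d \<circ> transpose q a)"
      using H(5,6) fa q by (intro cycle_on_comp[OF H(2) cycle_on_transpose]) auto
    have "cycle_on (X \<union> {q, a}) ((g \<circ> c \<circ> d) \<circ> transpose q a)"
      using q fa by (intro cycle_on_comp[OF H(3) cycle_on_transpose]) auto
    moreover have "A \<inter> (X \<union> {q, a}) = {a}" using a q cycle(3) by auto
    ultimately have "cycle_on (A \<union> (X \<union> {q, a})) (f \<circ> ((g \<circ> c \<circ> d) \<circ> transpose q a))"
      by (intro cycle_on_comp[OF cycle(1)])
    moreover have "A \<union> (X \<union> {q, a}) = A \<union> X" using a q by auto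
    moreover have "f \<circ> ((g \<circ> c \<circ> d) \<circ> transpose q a) = (f \<circ> g) \<circ> c \<circ> (d \<circ> transpose q a)"
      by (simp only: comp_assoc)
    ultimately have cyc: "cycle_on (A \<union> X) ((f \<circ> g) \<circ> c \<circ> (d \<circ> transpose q a))" by simp
    have "(g \<circ> c \<circ> d) a = a" using cycle_on_not_in[OF H(3)] fa by simp
    then have "((f \<circ> g) \<circ> c \<circ> (d \<circ> transpose q a)) q = f a" by simp
    moreover have "f a \<in> A \<union> X - (U \<union> (Q \<union> {q, a}))" using fa H(5) q cycle(3) by auto
    ultimately have free: "((f \<circ> g) \<circ> c \<circ> (d \<circ> transpose q a)) q \<in> A \<union> X - (U \<union> (Q \<union> {q, a}))"
      by simp
    have "Q \<union> {q, a} = insert a Q" "a \<notin> Q" using H(5,6) fa by auto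
    then have cQ: "card (Q \<union> {q, a}) = card Q + 1" using finQ by simp
    show ?thesis
    proof (intro exI conjI)
      show "period_on p U c" by fact
      show "cycle_on (Q \<union> {q, a}) (d \<circ> transpose q a)" by fact
      show "cycle_on (A \<union> X) ((f \<circ> g) \<circ> c \<circ> (d \<circ> transpose q a))" by fact
      show "((f \<circ> g) \<circ> c \<circ> (d \<circ> transpose q a)) q \<in> A \<union> X - (U \<union> (Q \<union> {q, a}))" by fact
      show "U \<inter> (Q \<union> {q, a}) = {}" "U \<union> (Q \<union> {q, a}) \<subseteq> A \<union> X" "q \<in> Q \<union> {q, a}"
        using H(4-6) fa a by auto
      show "card (Q \<union> {q, a}) \<le> p" using H(7) cQ by simp
      \<comment> \<open>\<open>Q\<close> gains one point while the support gains
        \<open>card A\<close>, at least two.\<close>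
      show "card U + 2 * card (Q \<union> {q, a}) \<le> card (A \<union> X)"
        "U = {} \<or> card U + 2 * card (Q \<union> {q, a}) + p \<le> card (A \<union> X) + 2"
        using H(8,9) cQ crd cycle(2) by auto
    qed
  qed
  from cycle(6) show ?case
  proof
    assume "X = {}"
    then have "g = id" using cycle(5) by simp
    have "?M A f"
    proof (intro exI conjI)
      show "period_on p {} id" by (rule period_on_id)
      show "cycle_on {a} id" by (rule cycle_on_singleton)
      show "cycle_on A (f \<circ> id \<circ> id)" using cycle(1) by simp
    qed (use a fa cycle(2) assms(4) in auto)
    then show ?thesis using \<open>X = {}\<close> \<open>g = id\<close> by simp
  next
    assume "?M X g"
    then obtain c d U Q q where H: "period_on p U c" "cycle_on Q d" "cycle_on X (g \<circ> c \<circ> d)" "U \<inter> Q = {}"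
      "U \<union> Q \<subseteq> X" "q \<in> Q" "(g \<circ> c \<circ> d) q \<in> X - (U \<union> Q)" "card Q \<le> p" "card U + 2 * card Q \<le> card X"
      "U = {} \<or> card U + 2 * card Q + p \<le> card X + 2"
      by blast
    show ?thesis
    proof (cases "card Q < p")
      case True
      then show ?thesis using extend[OF H(1-6) _ H(9,10)] by blast
    next
      case False
      then have cQ: "card Q = p" using H(8) by simp
      define z where "z = (g \<circ> c \<circ> d) q"
      have z: "z \<in> X" "z \<notin> U \<union> Q" using H(7) by (auto simp: z_def)
      have per: "period_on p (U \<union> Q) (c \<circ> d)"
        using period_on_comp_disjoint[OF H(1) period_on_cycle[OF H(2) cQ] H(4)] .
      have cyc: "cycle_on X (g \<circ> (c \<circ> d) \<circ> id)" using H(3) by (simp add: comp_assoc)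
      have "finite U" "finite Q" using H(5) cycle(4) finite_subset by blast+
      then have "card (U \<union> Q) = card U + p" using H(4) cQ by (simp add: card_Un_disjoint)
      then show ?thesis
        using extend[OF per cycle_on_singleton cyc, of z z] z H(5,9) cQ assms(4) by simp
    qed
  qed
qed

lemma fill_period:
  assumes "cycle_on Y (g \<circ> c \<circ> d)" "period_on p U c" "cycle_on Q d" "U \<inter> Q = {}" "q \<in> Q" "q \<in> Y"
    and "odd (card Q)" "odd p" "card Q \<le> p" "p \<le> card Q + card (Y - (U \<union> Q))"
  shows "\<exists>c'. period_on p (U \<union> Q \<union> Y) c' \<and> cycle_on Y (g \<circ> c')"
proof -
  have "p - card Q \<le> card (Y - (U \<union> Q))" using assms(10) by simp
  then obtain S where S: "S \<subseteq> Y - (U \<union> Q)" "card S = p - card Q" "finite S"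
    by (rule obtain_subset_with_card_n)
  have "q \<notin> S" using S(1) assms(5) by auto
  then have "odd (card (insert q S))" using S(2,3) assms(7-9) by simp
  moreover have "insert q S \<subseteq> Y" using S(1) assms(6) by auto
  ultimately obtain t where t: "cycle_on (insert q S) t" "cycle_on Y ((g \<circ> c \<circ> d) \<circ> t)"
    using cycle_on_extend[OF assms(1)] by blast
  have dt: "cycle_on (Q \<union> insert q S) (d \<circ> t)"
    using S(1) assms(5) by (intro cycle_on_comp[OF assms(3) t(1)]) auto
  have "Q \<union> insert q S = Q \<union> S" "Q \<inter> S = {}" using S(1) assms(5) by auto
  then have "card (Q \<union> insert q S) = p"
    using S(2,3) assms(9) cycle_on_finite[OF assms(3)] by (simp add: card_Un_disjoint)
  then have "period_on p (U \<union> (Q \<union> insert q S)) (c \<circ> (d \<circ> t))"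
    using S(1) assms(4,5) period_on_cycle[OF dt] by (intro period_on_comp_disjoint[OF assms(2)]) auto
  then have "period_on p (U \<union> Q \<union> Y) (c \<circ> (d \<circ> t))"
    using S(1) assms(6) by (elim period_on_mono) auto
  moreover have "cycle_on Y (g \<circ> (c \<circ> (d \<circ> t)))" using t(2) by (simp add: comp_assoc)
  ultimately show ?thesis by blast
qed

lemma evenperm_merge_to_cycle:
  assumes "finite N" "g permutes N" "evenperm g" "odd p" "3 \<le> p" "p \<le> card N" "g \<noteq> id"
  shows "\<exists>Y c. period_on p N c \<and> cycle_on Y (g \<circ> c) \<and> Y \<subseteq> N \<and> odd (card Y) \<and> p \<le> card Y"
proof -
  define X where "X = {x \<in> N. g x \<noteq> x}"
  have XN: "X \<subseteq> N" and finX: "finite X" using assms(1) by (auto simp: X_def)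
  have gX: "g permutes X" using permutes_support[OF assms(2)] by (simp add: X_def)
  have "X \<noteq> {}" using gX assms(7) by auto
  moreover have "2 \<le> p" using assms(5) by simp
  ultimately obtain c d U Q q where H: "period_on p U c" "cycle_on Q d" "cycle_on X (g \<circ> c \<circ> d)" "U \<inter> Q = {}"
      "U \<union> Q \<subseteq> X" "q \<in> Q" "(g \<circ> c \<circ> d) q \<in> X - (U \<union> Q)" "card Q \<le> p" "card U + 2 * card Q \<le> card X"
      "U = {} \<or> card U + 2 * card Q + p \<le> card X + 2"
    using merge_cycles[OF finX gX, of p] by (auto simp: X_def)
  have fin: "finite U" "finite Q" using H(5) finX finite_subset by blast+
  have Qpos: "1 \<le> card Q" using H(6) fin(2) by (metis One_nat_def Suc_leI card_gt_0_iff empty_iff)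
  have cUQ: "card (U \<union> Q) = card U + card Q" using fin H(4) by (simp add: card_Un_disjoint)
  \<comment> \<open>Both \<open>g\<close> and \<open>c\<close> are even, so the cycles
    \<open>g \<circ> c \<circ> d\<close> and \<open>d\<close> have the same sign.\<close>
  have parity: "odd (card X) \<longleftrightarrow> odd (card Q)"
  proof -
    have ce: "evenperm c" using period_on_odd_evenperm[OF H(1) assms(4) fin(1)] .
    have perms: "permutation g" "permutation c" "permutation d"
      using permutes_imp_permutation assms(1,2) fin(1) period_on_permutes[OF H(1)]
        cycle_on_permutation[OF H(2)] by auto
    have "odd (card X) \<longleftrightarrow> evenperm (g \<circ> c \<circ> d)"
      using cycle_on_evenperm[OF H(3) \<open>X \<noteq> {}\<close>] by simp
    also have "\<dots> \<longleftrightarrow> evenperm d"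
      using evenperm_comp[OF permutation_compose[OF perms(1,2)] perms(3)]
        evenperm_comp[OF perms(1,2)] ce assms(3) by simp
    also have "\<dots> \<longleftrightarrow> odd (card Q)"
      using cycle_on_evenperm[OF H(2)] H(6) by auto
    finally show ?thesis .
  qed
  have qX: "q \<in> X" using H(5,6) by auto
  consider "p \<le> card X" "odd (card X)" | "p \<le> card X" "even (card X)" | "card X < p"
    by linarith
  then show ?thesis
  proof cases
    case 1
    have "card (X - (U \<union> Q)) = card X - (card U + card Q)"
      using cUQ card_Diff_subset[OF finite_UnI[OF fin] H(5)] by simp
    \<comment> \<open>For empty \<open>U\<close> this is \<open>p \<le> card X\<close>; otherwise
      the last bound of \<open>merge_cycles\<close> provides the points.\<close>
    then have "p \<le> card Q + card (X - (U \<union> Q))" using H(9,10) 1(1) Qpos by auto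
    then obtain c' where c': "period_on p (U \<union> Q \<union> X) c'" "cycle_on X (g \<circ> c')"
      using fill_period[OF H(3,1,2,4,6) qX _ assms(4) H(8)] parity 1(2) by blast
    have "U \<union> Q \<union> X \<subseteq> N" using H(5) XN by auto
    then have "period_on p N c'" using period_on_mono c'(1) by blast
    then show ?thesis using c'(2) XN 1 by blast
  next
    case 2
    \<comment> \<open>Moving \<open>y\<close> from the merged cycle into \<open>d\<close> makes both
      lengths odd. There is room in \<open>d\<close>, since \<open>card Q\<close> is even and hence
      different from \<open>p\<close>.\<close>
    define y where "y = (g \<circ> c \<circ> d) q"
    have y: "y \<in> X" "y \<notin> U" "y \<notin> Q" "y \<noteq> q" using H(6,7) by (auto simp: y_def)
    have "2 \<le> card X" using 2(1) assms(5) by simp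
    have "cycle_on (X - {y}) ((g \<circ> c \<circ> d) \<circ> transpose q y)"
      unfolding y_def by (rule cycle_on_drop_point[OF H(3) qX \<open>2 \<le> card X\<close>])
    then have h': "cycle_on (X - {y}) (g \<circ> c \<circ> (d \<circ> transpose q y))" by (simp only: comp_assoc)
    have d': "cycle_on (Q \<union> {q, y}) (d \<circ> transpose q y)"
      using y H(6) by (intro cycle_on_comp[OF H(2) cycle_on_transpose]) auto
    have ins: "Q \<union> {q, y} = insert y Q" using H(6) by auto
    have cQ: "card (Q \<union> {q, y}) = card Q + 1" using ins y(3) fin(2) by simp
    have "even (card Q)" using parity 2(2) by simp
    then have "card Q + 1 \<le> p" using H(8) assms(4) by (metis Suc_eq_plus1 le_neq_implies_less Suc_leI)
    have "X - {y} - (U \<union> (Q \<union> {q, y})) = X - insert y (U \<union> Q)" using ins by auto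
    moreover have "card (X - insert y (U \<union> Q)) = card X - (card U + card Q + 1)"
      using cUQ y fin H(5) card_Diff_subset[of "insert y (U \<union> Q)" X] by simp
    ultimately have "card (X - {y} - (U \<union> (Q \<union> {q, y}))) = card X - (card U + card Q + 1)" by simp
    then have "p \<le> card (Q \<union> {q, y}) + card (X - {y} - (U \<union> (Q \<union> {q, y})))"
      using cQ H(9,10) 2(1) Qpos by auto
    moreover have "odd (card (Q \<union> {q, y}))" using cQ \<open>even (card Q)\<close> by simp
    moreover have "card (Q \<union> {q, y}) \<le> p" using cQ \<open>card Q + 1 \<le> p\<close> by simp
    moreover have "U \<inter> (Q \<union> {q, y}) = {}" "q \<in> Q \<union> {q, y}" "q \<in> X - {y}"
      using H(4,6) y qX by auto
    ultimately obtain c' where c': "period_on p (U \<union> (Q \<union> {q, y}) \<union> (X - {y})) c'" "cycle_on (X - {y}) (g \<circ> c')"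
      using fill_period[OF h' H(1) d' _ _ _ _ assms(4)] by blast
    have "U \<union> (Q \<union> {q, y}) \<union> (X - {y}) \<subseteq> N" using H(5) XN y qX by auto
    then have "period_on p N c'" using period_on_mono c'(1) by blast
    moreover have "card (X - {y}) = card X - 1" using y(1) finX by simp
    moreover have "p \<noteq> card X" using 2(2) assms(4) by auto
    ultimately show ?thesis
      using c'(2) XN 2 assms(5) by (intro exI[of _ "X - {y}"] exI[of _ c']) auto
  next
    case 3
    \<comment> \<open>No \<open>p\<close>-cycle can be complete yet. Fixed points of
      \<open>g\<close> are added to both cycles through \<open>v\<close>, bringing the merged one to
      length exactly \<open>p\<close>.\<close>
    have "U = {}" using H(10) Qpos 3 fin(1) by (cases "U = {}") auto
    have "p - card X \<le> card (N - X)" using assms(6) card_Diff_subset[OF finX XN] by simp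
    then obtain V where V: "V \<subseteq> N - X" "card V = p - card X" "finite V"
      by (rule obtain_subset_with_card_n)
    obtain v where v: "cycle_on (insert q V) v" using cycle_on_exists V(3) by blast
    have "cycle_on (X \<union> insert q V) ((g \<circ> c \<circ> d) \<circ> v)"
      using V(1) qX by (intro cycle_on_comp[OF H(3) v]) auto
    moreover have XV: "X \<union> insert q V = X \<union> V" using qX by auto
    ultimately have h': "cycle_on (X \<union> V) (g \<circ> c \<circ> (d \<circ> v))" by (simp add: comp_assoc)
    have "cycle_on (Q \<union> insert q V) (d \<circ> v)"
      using V(1) H(5,6) by (intro cycle_on_comp[OF H(2) v]) auto
    moreover have "Q \<union> insert q V = Q \<union> V" using H(6) by auto
    ultimately have d': "cycle_on (Q \<union> V) (d \<circ> v)" by simp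
    have disj: "X \<inter> V = {}" "Q \<inter> V = {}" using V(1) H(5) by auto
    have cX: "card (X \<union> V) = p" using disj finX V(2,3) 3 by (simp add: card_Un_disjoint)
    have cQ: "card (Q \<union> V) = card Q + (p - card X)" using disj fin(2) V(2,3) by (simp add: card_Un_disjoint)
    have QX: "card Q \<le> card X" using H(9) by simp
    have "X \<union> V - ({} \<union> (Q \<union> V)) = X - Q" using disj by auto
    then have "card (X \<union> V - ({} \<union> (Q \<union> V))) = card X - card Q"
      using card_Diff_subset[OF fin(2)] H(5) by simp
    \<comment> \<open>Equality holds here: completing \<open>d\<close> uses up all of
      \<open>X - Q\<close>.\<close>
    then have "p \<le> card (Q \<union> V) + card (X \<union> V - ({} \<union> (Q \<union> V)))" using cQ QX 3 by simp
    moreover have "odd (card (Q \<union> V))" using cQ parity 3 assms(4) by auto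
    moreover have "card (Q \<union> V) \<le> p" using cQ QX 3 by simp
    ultimately obtain c' where c': "period_on p ({} \<union> (Q \<union> V) \<union> (X \<union> V)) c'" "cycle_on (X \<union> V) (g \<circ> c')"
      using fill_period[OF h' _ d' _ _ _ _ assms(4), of "{}" q] H(1,6) qX \<open>U = {}\<close> by auto
    have "{} \<union> (Q \<union> V) \<union> (X \<union> V) \<subseteq> N" using H(5) XN V(1) by auto
    then have "period_on p N c'" using period_on_mono c'(1) by blast
    moreover have "X \<union> V \<subseteq> N" using XN V(1) by auto
    ultimately show ?thesis using c'(2) cX assms(4) by (metis order_refl)
  qed
qed

lemma evenperm_three_period:
  assumes "finite N" "g permutes N" "evenperm g" "odd p" "3 \<le> p" "p \<le> card N"
  shows "\<exists>a b c. period_on p N a \<and> period_on p N b \<and> period_on p N c \<and> g = a \<circ> b \<circ> c"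
proof (cases "g = id")
  case True
  then have "g = id \<circ> id \<circ> id" by simp
  then show ?thesis using period_on_id by blast
next
  case False
  obtain Y c where Y: "period_on p N c" "cycle_on Y (g \<circ> c)" "Y \<subseteq> N" "odd (card Y)" "p \<le> card Y"
    using evenperm_merge_to_cycle[OF assms False] by blast
  have "Y \<noteq> {}" using Y(4) by auto
  then obtain z where "z \<in> Y" by blast
  then obtain a b where ab: "period_on p Y a" "period_on p Y b" "g \<circ> c = a \<circ> b"
    using cycle_on_two_period[OF Y(2) _ assms(4,5) Y(4,5)] by blast
  have "g = g \<circ> c \<circ> inv' c"
    using permutes_inv_o(1)[OF period_on_permutes[OF Y(1)]] by (simp add: comp_assoc)
  then have "g = a \<circ> b \<circ> inv' c" using ab(3) by simp
  then show ?thesis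
    using period_on_mono[OF ab(1) Y(3)] period_on_mono[OF ab(2) Y(3)] period_on_inv[OF Y(1)] by blast
qed

subsection \<open>Even involutions\<close>

text \<open>The two involutions live on the support of \<open>g\<close> and have equal parity. If
  they are odd, the transposition of \<open>x\<close> and \<open>y\<close> commutes with both,
  corrects their parity and cancels in the product.\<close>

lemma evenperm_two_even_involutions:
  assumes "finite N" "g permutes N" "evenperm g" "x \<in> N" "y \<in> N" "x \<noteq> y" "g x = x" "g y = y"
  shows "\<exists>a b. period_on 2 N a \<and> period_on 2 N b \<and> evenperm a \<and> evenperm b \<and> g = a \<circ> b"
proof -
  define X where "X = {x \<in> N. g x \<noteq> x}"
  have XN: "X \<subseteq> N" "finite X" "x \<notin> X" "y \<notin> X" using assms by (auto simp: X_def)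
  have gX: "g permutes X" using permutes_support[OF assms(2)] by (simp add: X_def)
  obtain a b where ab: "period_on 2 X a" "period_on 2 X b" "g = a \<circ> b"
    using two_involutions[OF XN(2) gX] by (auto simp: X_def)
  have perm: "permutation a" "permutation b"
    using ab(1,2) XN(2) permutes_imp_permutation period_on_permutes by blast+
  then have same: "evenperm a \<longleftrightarrow> evenperm b" using assms(3) ab(3) evenperm_comp by blast
  show ?thesis
  proof (cases "evenperm a")
    case True
    then show ?thesis using ab same period_on_mono[OF _ XN(1)] by blast
  next
    case False
    let ?t = "transpose x y"
    have t: "period_on 2 {x, y} ?t" by (intro period_two_transpose) auto
    have dis: "X \<inter> {x, y} = {}" using XN by auto
    have sub: "X \<union> {x, y} \<subseteq> N" using XN assms(4,5) by auto
    have "period_on 2 (X \<union> {x, y}) (a \<circ> ?t)" "period_on 2 (X \<union> {x, y}) (b \<circ> ?t)"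
      using period_on_comp_disjoint ab(1,2) t dis by blast+
    then have "period_on 2 N (a \<circ> ?t)" "period_on 2 N (b \<circ> ?t)"
      using period_on_mono sub by blast+
    moreover have "evenperm (a \<circ> ?t)" "evenperm (b \<circ> ?t)"
      using False same assms(6) perm by (simp_all add: evenperm_comp permutation_swap_id evenperm_swap)
    moreover have "g = (a \<circ> ?t) \<circ> (b \<circ> ?t)"
    proof -
      have "?t \<circ> b = b \<circ> ?t"
        using permutes_disjoint_commute[OF period_on_permutes[OF ab(2)] period_on_permutes[OF t] dis] by simp
      then have "(a \<circ> ?t) \<circ> (b \<circ> ?t) = a \<circ> (?t \<circ> ?t) \<circ> b"
        by (metis comp_assoc)
      then show ?thesis using ab(3) by simp
    qed
    ultimately show ?thesis by blast
  qed
qed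

lemma evenperm_three_even_involutions:
  assumes "finite N" "g permutes N" "evenperm g" "5 \<le> card N"
  shows "\<exists>a b c. period_on 2 N a \<and> period_on 2 N b \<and> period_on 2 N c
    \<and> evenperm a \<and> evenperm b \<and> evenperm c \<and> g = a \<circ> b \<circ> c"
proof (cases "\<exists>x\<in>N. \<exists>y\<in>N. x \<noteq> y \<and> g x = x \<and> g y = y")
  case True
  then obtain a b where "period_on 2 N a" "period_on 2 N b" "evenperm a" "evenperm b" "g = a \<circ> b"
    using evenperm_two_even_involutions[OF assms(1-3)] by blast
  moreover have "g = a \<circ> b \<circ> id" using \<open>g = a \<circ> b\<close> by simp
  ultimately show ?thesis using period_on_id evenperm_id by blast
next
  case False
  define X where "X = {x \<in> N. g x \<noteq> x}"
  have finX: "finite X" using assms(1) by (simp add: X_def)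
  have "card (N - X) \<le> 1"
    using False assms(1) by (intro card_le_Suc0_iff_eq[THEN iffD2, folded One_nat_def]) (auto simp: X_def)
  moreover have "card (N - X) = card N - card X"
    using finX by (intro card_Diff_subset) (auto simp: X_def)
  ultimately have X4: "4 \<le> card X" using assms(4) by simp
  then have "X \<noteq> {}" by auto
  then obtain x where x: "x \<in> X" by blast
  have "card {x, g x, inv' g x} \<le> 3" by (simp add: card_insert_if)
  \<comment> \<open>With four moved points, \<open>y\<close> can avoid \<open>x\<close>, its image
    and its preimage, so that \<open>x\<close>, \<open>g x\<close>, \<open>y\<close>,
    \<open>g y\<close> are distinct.\<close>
  then have "\<not> X \<subseteq> {x, g x, inv' g x}"
    using X4 card_mono[of "{x, g x, inv' g x}" X] by fastforce
  then obtain y where y: "y \<in> X" "y \<noteq> x" "y \<noteq> g x" "y \<noteq> inv' g x" by blast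
  have gy: "g y \<noteq> x" using y(4) permutes_inverses(2)[OF assms(2), of y] by auto
  have gxy: "g x \<noteq> g y" using y(2) permutes_inj[OF assms(2)] by (auto dest: injD)
  have N: "x \<in> N" "y \<in> N" "g x \<in> N" "g y \<in> N" "g x \<noteq> x" "g y \<noteq> y"
    using x y(1) permutes_in_image[OF assms(2)] by (auto simp: X_def)
  \<comment> \<open>This double transposition sends \<open>g x\<close> back to \<open>x\<close> and
    \<open>g y\<close> back to \<open>y\<close>, so \<open>?c \<circ> g\<close> has two fixed
    points.\<close>
  let ?c = "transpose x (g x) \<circ> transpose y (g y)"
  have "period_on 2 {x, g x} (transpose x (g x))" "period_on 2 {y, g y} (transpose y (g y))"
    by (auto intro: period_two_transpose)
  then have "period_on 2 ({x, g x} \<union> {y, g y}) ?c"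
    using y gy gxy by (intro period_on_comp_disjoint) auto
  then have pc: "period_on 2 N ?c" using N by (elim period_on_mono) auto
  have ec: "evenperm ?c"
    using N by (simp add: evenperm_comp permutation_swap_id evenperm_swap del: comp_apply)
  have "evenperm (?c \<circ> g)"
    using ec assms(1-3) permutes_imp_permutation period_on_permutes[OF pc]
      evenperm_comp[of ?c g] by blast
  moreover have "?c \<circ> g permutes N"
    by (rule permutes_compose[OF assms(2) period_on_permutes[OF pc]])
  moreover have "(?c \<circ> g) x = x" "(?c \<circ> g) y = y"
    using y gy gxy N by (simp_all add: transpose_def)
  ultimately obtain a b where ab: "period_on 2 N a" "period_on 2 N b" "evenperm a" "evenperm b" "?c \<circ> g = a \<circ> b"
    using evenperm_two_even_involutions[OF assms(1), of "?c \<circ> g" x y] N(1,2) y(2) by metis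
  have "?c \<circ> ?c = id" using pc by (simp add: period_on_def numeral_eq_Suc del: comp_apply)
  then have "g = ?c \<circ> (?c \<circ> g)" by (metis comp_assoc id_comp)
  then have "g = ?c \<circ> a \<circ> b" unfolding ab(5) by (simp only: comp_assoc)
  then show ?thesis using ab pc ec by blast
qed

subsection \<open>The width\<close>

lemma alt_group_pow: "f [^]\<^bsub>alt_group n\<^esub> (k::nat) = f ^^ k"
proof (induction k)
  case 0
  then show ?case by (simp add: alt_group_one)
next
  case (Suc k)
  have "f [^]\<^bsub>alt_group n\<^esub> Suc k = f ^^ k \<circ> f"
    using Suc by (simp add: alt_group_mult)
  then show ?case by (simp only: funpow_Suc_right)
qed

lemma period_on_order_p:
  assumes "prime p" "period_on p {1..n} f" "evenperm f" "f \<noteq> id"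
  shows "f \<in> order_p_elements p (alt_group n)"
proof -
  interpret group "alt_group n" by (rule alt_group_is_group)
  have f: "f \<in> carrier (alt_group n)"
    using assms(2,3) by (simp add: alt_group_carrier period_on_def)
  have "f [^]\<^bsub>alt_group n\<^esub> p = \<one>\<^bsub>alt_group n\<^esub>"
    using assms(2) by (simp add: alt_group_pow alt_group_one period_on_def)
  then have "ord f dvd p" using f pow_eq_id by blast
  moreover have "ord f \<noteq> 1" using ord_eq_1[OF f] assms(4) by (simp add: alt_group_one)
  ultimately have "ord f = p" using assms(1) prime_nat_iff by blast
  then show ?thesis using f by (simp add: order_p_elements_def)
qed

text \<open>Identity factors do not have order \<open>p\<close>; dropping them only shortens the
  product.\<close>

lemma foldr_comp_filter_id: "foldr (\<circ>) (filter (\<lambda>f. f \<noteq> id) xs) id = foldr (\<circ>) xs id"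
  by (induction xs) auto

theorem theorem2p1:
  fixes p n :: nat
  assumes "Factorial_Ring.prime p" and "n \<ge> 5" and "n \<ge> p"
  shows "p_width p (alt_group n) \<le> 3"
proof -
  have "carrier (alt_group n) \<subseteq> products_of_order_p_elements p (alt_group n) 3"
  proof
    fix g assume "g \<in> carrier (alt_group n)"
    then have g: "g permutes {1..n}" "evenperm g" by (simp_all add: alt_group_carrier)
    have "\<exists>a b c. period_on p {1..n} a \<and> period_on p {1..n} b \<and> period_on p {1..n} c
      \<and> evenperm a \<and> evenperm b \<and> evenperm c \<and> g = a \<circ> b \<circ> c"
    proof (cases "p = 2")
      case True
      then show ?thesis using evenperm_three_even_involutions[OF _ g] assms(2) by simp
    next
      case False
      then have "odd p" "3 \<le> p"
        using assms(1) prime_odd_nat[of p] prime_ge_2_nat[OF assms(1)] by auto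
      then show ?thesis
        using evenperm_three_period[OF _ g, of p] assms(3) period_on_odd_evenperm[of p "{1..n}"]
        by simp blast
    qed
    then obtain a b c where abc: "period_on p {1..n} a" "period_on p {1..n} b" "period_on p {1..n} c"
      "evenperm a" "evenperm b" "evenperm c" "g = a \<circ> b \<circ> c"
      by blast
    let ?xs = "filter (\<lambda>f. f \<noteq> id) [a, b, c]"
    have "set ?xs \<subseteq> order_p_elements p (alt_group n)"
      using abc period_on_order_p[OF assms(1)] by auto
    moreover have "length ?xs \<le> 3" using length_filter_le[of _ "[a, b, c]"] by simp
    moreover have "g = foldr (\<otimes>\<^bsub>alt_group n\<^esub>) ?xs \<one>\<^bsub>alt_group n\<^esub>"
      unfolding alt_group_mult alt_group_one foldr_comp_filter_id abc(7) by (simp add: comp_assoc)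
    ultimately show "g \<in> products_of_order_p_elements p (alt_group n) 3"
      unfolding products_of_order_p_elements_def by blast
  qed
  then have "p_width p (alt_group n) \<le> enat 3"
    unfolding p_width_def by (intro Inf_lower) blast
  then show ?thesis by (simp add: numeral_eq_enat)
qed

end
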